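(* Let $\mathcal{P}=\{X_i\mid i\in I\}$ be a partition of a nonempty set $X$ and let $f\in\Sigma(X,\mathcal{P})$. Then $f$ is unit-regular in $\Sigma(X,\mathcal{P})$ if and only if both of the following hold: (i) $\chi^{(f)}\in\Omega(I)$; (ii) whenever $i\chi^{(f)}=j$ (with $i,j\in I$), one has $|X_i|=|X_j|$ and $\mathrm{c}(f_i)=\mathrm{d}(f_i)$, where $f_i\in B(f,I)$.
   Context: Maps are written to the right of their arguments and composed from left to right; $Af$ denotes the image of $A$ under $f$. $X$ may be finite or infinite. A partition $\mathcal{P}=\{X_i\mid i\in I\}$ of $X$ is a collection of nonempty pairwise disjoint subsets (blocks) with union $X$, with distinct indices giving distinct blocks. $T(X)$ is the monoid of all selfmaps of $X$ under composition. $T(X,\mathcal{P})=\{f\in T(X)\mid (\forall X_i\in\mathcal{P})(\exists X_j\in\mathcal{P})\ X_if\subseteq X_j\}$, and $\Sigma(X,\mathcal{P})=\{f\in T(X,\mathcal{P})\mid (\forall X_i\in\mathcal{P})\ Xf\cap X_i\neq\emptyset\}$, a submonoid of $T(X,\mathcal{P})$. An element $x$ of a monoid $M$ is unit-regular in $M$ if there is a unit $u$ of $M$ with $xux=x$. For $f\in T(X,\mathcal{P})$, the character $\chi^{(f)}\colon I\to I$ is defined by $i\chi^{(f)}=j$ whenever $X_if\subseteq X_j$. $\Omega(I)$ is the monoid of all injective maps $I\to I$. $B(f,I)=\{f_i\mid i\in I\}$, where $f_i\colon X_i\to X_{i\chi^{(f)}}$, $xf_i=xf$, is the map induced by $f$.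 For a map $h\colon A\to B$, the collapse is $\mathrm{c}(h)=|A\setminus T_h|$, where $T_h$ is any cross-section of $\ker(h)=\{(x,y)\in A\times A\mid xh=yh\}$ (a subset of $A$ meeting each class in exactly one point), and the defect is $\mathrm{d}(h)=|B\setminus Ah|$. *)

theory Defs
  imports Main "HOL-Algebra.Group" "HOL-Library.FuncSet" "HOL-Library.Disjoint_Sets"
begin

unbundle cardinal_syntax

text \<open>
  Maps are written on the right and composed from left to right in the source; here they are
  ordinary functions, extensional on their domain, and the product of \<open>f\<close> and \<open>g\<close> is
  ``first \<open>f\<close>, then \<open>g\<close>''. An indexed partition is a family \<open>P\<close> of blocks over an index set \<open>I\<close>.
\<close>

definition indexed_partition :: "'a set \<Rightarrow> 'i set \<Rightarrow> ('i \<Rightarrow> 'a set) \<Rightarrow> bool" where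
  "indexed_partition X I P \<longleftrightarrow> inj_on P I \<and> partition_on X (P ` I)"

definition full_transf :: "'a set \<Rightarrow> ('a \<Rightarrow> 'a) monoid" where
  "full_transf X =
     \<lparr>carrier = X \<rightarrow>\<^sub>E X, mult = (\<lambda>f g. compose X g f), one = (\<lambda>x\<in>X. x)\<rparr>"

definition partition_transf :: "'a set \<Rightarrow> 'i set \<Rightarrow> ('i \<Rightarrow> 'a set) \<Rightarrow> ('a \<Rightarrow> 'a) monoid" where
  "partition_transf X I P = (full_transf X)
     \<lparr>carrier := {f \<in> carrier (full_transf X). \<forall>i\<in>I. \<exists>j\<in>I. f ` P i \<subseteq> P j}\<rparr>"

definition Sigma_transf :: "'a set \<Rightarrow> 'i set \<Rightarrow> ('i \<Rightarrow> 'a set) \<Rightarrow> ('a \<Rightarrow> 'a) monoid" where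
  "Sigma_transf X I P = (partition_transf X I P)
     \<lparr>carrier := {f \<in> carrier (partition_transf X I P). \<forall>i\<in>I. f ` X \<inter> P i \<noteq> {}}\<rparr>"

definition inj_transf :: "'a set \<Rightarrow> ('a \<Rightarrow> 'a) monoid" where
  "inj_transf X = (full_transf X)
     \<lparr>carrier := {f \<in> carrier (full_transf X). inj_on f X}\<rparr>"

definition unit_regular :: "('a, 'b) monoid_scheme \<Rightarrow> 'a \<Rightarrow> bool" where
  "unit_regular M x \<longleftrightarrow> x \<in> carrier M \<and> (\<exists>u\<in>Units M. x \<otimes>\<^bsub>M\<^esub> u \<otimes>\<^bsub>M\<^esub> x = x)"

text \<open>The index \<open>j\<close> below is unique since the blocks are nonempty and pairwise disjoint.\<close>

definition "character" :: "'i set \<Rightarrow> ('i \<Rightarrow> 'a set) \<Rightarrow> ('a \<Rightarrow> 'a) \<Rightarrow> 'i \<Rightarrow> 'i" where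
  "character I P f = (\<lambda>i\<in>I. THE j. j \<in> I \<and> f ` P i \<subseteq> P j)"

definition block_map :: "('i \<Rightarrow> 'a set) \<Rightarrow> ('a \<Rightarrow> 'a) \<Rightarrow> 'i \<Rightarrow> 'a \<Rightarrow> 'a" where
  "block_map P f i = restrict f (P i)"

definition map_kernel :: "'a set \<Rightarrow> ('a \<Rightarrow> 'b) \<Rightarrow> ('a \<times> 'a) set" where
  "map_kernel A h = {(x, y) \<in> A \<times> A. h x = h y}"

definition cross_section :: "'a set \<Rightarrow> ('a \<Rightarrow> 'b) \<Rightarrow> 'a set \<Rightarrow> bool" where
  "cross_section A h T \<longleftrightarrow> T \<subseteq> A \<and> (\<forall>C \<in> A // map_kernel A h. \<exists>!x. x \<in> C \<inter> T)"

text \<open>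
  Collapse and defect are cardinals, to be compared with \<open>=o\<close>. The choice of the cross-section
  does not matter up to \<open>=o\<close>: see \<open>collapse_cross_section\<close>.
\<close>

definition collapse :: "'a set \<Rightarrow> ('a \<Rightarrow> 'b) \<Rightarrow> 'a rel" where
  "collapse A h = |A - (SOME T. cross_section A h T)|"

definition defect :: "'a set \<Rightarrow> 'b set \<Rightarrow> ('a \<Rightarrow> 'b) \<Rightarrow> 'b rel" where
  "defect A B h = |B - h ` A|"

lemma cross_section_iff:
  "cross_section A h T \<longleftrightarrow> T \<subseteq> A \<and> (\<forall>a\<in>A. \<exists>!x. x \<in> T \<and> h x = h a)"
proof (cases "T \<subseteq> A")
  case True
  then have "x \<in> map_kernel A h `` {a} \<inter> T \<longleftrightarrow> x \<in> T \<and> h x = h a" if "a \<in> A" for a x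
    using that by (auto simp: map_kernel_def)
  then show ?thesis
    using True unfolding cross_section_def quotient_def by simp
qed (simp add: cross_section_def)

lemma cross_section_exists: "\<exists>T. cross_section A h T"
proof
  have "inv_into A h y \<in> A" "h (inv_into A h y) = y" if "y \<in> h ` A" for y
    using that by (rule inv_into_into, rule f_inv_into_f)
  then show "cross_section A h (inv_into A h ` h ` A)"
    unfolding cross_section_iff by auto
qed

lemma cross_section_card_of:
  assumes T: "cross_section A h T" and T': "cross_section A h T'"
  shows "|A - T| =o |A - T'|"
proof -
  define r where "r S a = (THE x. x \<in> S \<and> h x = h a)" for S a
  define F where "F S S' = (\<lambda>x. if x \<in> S' then r S x else x)" for S S'
  have step: "F S S' x \<in> A - S' \<and> F S' S (F S S' x) = x"
    if S: "cross_section A h S" and S': "cross_section A h S'" and x: "x \<in> A - S" for S S' x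
  proof (cases "x \<in> S'")
    case False
    with x show ?thesis by (simp add: F_def)
  next
    case True
    define t where "t = r S x"
    have "\<exists>!y. y \<in> S \<and> h y = h x"
      using S x by (simp add: cross_section_iff)
    from theI'[OF this] have t: "t \<in> S" "h t = h x"
      by (simp_all add: t_def r_def)
    have tA: "t \<in> A"
      using t S by (auto simp: cross_section_iff)
    then have ex1: "\<exists>!y. y \<in> S' \<and> h y = h t"
      using S' by (simp add: cross_section_iff)
    have "t \<notin> S'"
      using ex1 True t x by auto
    moreover have "r S' t = x"
      unfolding r_def using ex1 True t by (intro the1_equality) simp_all
    ultimately show ?thesis
      using True tA t by (simp add: F_def t_def[symmetric])
  qed
  have "bij_betw (F T T') (A - T) (A - T')"
    by (rule bij_betwI[where g = "F T' T"]) (use step T T' in blast)+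
  then show ?thesis
    using card_of_ordIso by blast
qed

lemma collapse_cross_section:
  "cross_section A h T \<Longrightarrow> collapse A h =o |A - T|"
  unfolding collapse_def
  using cross_section_card_of someI_ex[OF cross_section_exists] by blast

lemma indexed_partitionD:
  assumes P: "indexed_partition X I P"
  shows "i \<in> I \<Longrightarrow> P i \<noteq> {}" and "i \<in> I \<Longrightarrow> P i \<subseteq> X"
    and "x \<in> X \<Longrightarrow> \<exists>i\<in>I. x \<in> P i"
    and "\<lbrakk>i \<in> I; j \<in> I; x \<in> P i; x \<in> P j\<rbrakk> \<Longrightarrow> i = j"
proof -
  have inj: "inj_on P I" and X: "\<Union> (P ` I) = X" and dis: "disjoint (P ` I)" and ne: "{} \<notin> P ` I"
    using P by (simp_all add: indexed_partition_def partition_on_def)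
  show "P i \<noteq> {}" if "i \<in> I" using ne that by force
  show "P i \<subseteq> X" if "i \<in> I" using X that by blast
  show "\<exists>i\<in>I. x \<in> P i" if "x \<in> X" using X that by blast
  show "i = j" if ij: "i \<in> I" "j \<in> I" and x: "x \<in> P i" "x \<in> P j"
  proof -
    have "P i = P j"
      using disjointD[OF dis, of "P i" "P j"] ij x by blast
    with inj ij show ?thesis by (simp add: inj_on_eq_iff)
  qed
qed

lemma character_eq_iff:
  assumes P: "indexed_partition X I P" and f: "f \<in> carrier (partition_transf X I P)"
    and i: "i \<in> I" and j: "j \<in> I"
  shows "character I P f i = j \<longleftrightarrow> f ` P i \<subseteq> P j"
proof -
  obtain k where k: "k \<in> I" "f ` P i \<subseteq> P k"
    using f i by (auto simp: partition_transf_def)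
  obtain x where x: "x \<in> P i"
    using indexed_partitionD(1)[OF P i] by blast
  have unique: "l = k" if "l \<in> I \<and> f ` P i \<subseteq> P l" for l
    using that k x indexed_partitionD(4)[OF P, of l k "f x"] by blast
  have "(THE l. l \<in> I \<and> f ` P i \<subseteq> P l) = k"
    using k unique by (intro the_equality) blast+
  then have "character I P f i = k"
    using i by (simp add: character_def)
  then show ?thesis
    using unique j k by blast
qed

lemma monoid_full_transf: "monoid (full_transf X)"
proof
  fix f g h
  assume f: "f \<in> carrier (full_transf X)" and g: "g \<in> carrier (full_transf X)"
    and h: "h \<in> carrier (full_transf X)"
  show "f \<otimes>\<^bsub>full_transf X\<^esub> g \<otimes>\<^bsub>full_transf X\<^esub> h = f \<otimes>\<^bsub>full_transf X\<^esub> (g \<otimes>\<^bsub>full_transf X\<^esub> h)"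
    using f by (auto simp: full_transf_def compose_def restrict_def PiE_iff)
qed (auto simp: full_transf_def compose_def fun_eq_iff PiE_iff extensional_def)

lemma submonoid_partition_transf:
  assumes "indexed_partition X I P"
  shows "submonoid (carrier (partition_transf X I P)) (full_transf X)"
proof
  fix f g
  assume f: "f \<in> carrier (partition_transf X I P)" and g: "g \<in> carrier (partition_transf X I P)"
  have "\<exists>k\<in>I. compose X g f ` P i \<subseteq> P k" if i: "i \<in> I" for i
  proof -
    obtain j where j: "j \<in> I" "f ` P i \<subseteq> P j"
      using f i by (auto simp: partition_transf_def)
    obtain k where "k \<in> I" "g ` P j \<subseteq> P k"
      using g j by (auto simp: partition_transf_def)
    with j show ?thesis
      using indexed_partitionD(2)[OF assms i]
      by (intro bexI[of _ k]) (auto simp: compose_def)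
  qed
  with f g show "f \<otimes>\<^bsub>full_transf X\<^esub> g \<in> carrier (partition_transf X I P)"
    by (auto simp: partition_transf_def full_transf_def compose_def PiE_iff)
next
  have "\<exists>j\<in>I. (\<lambda>x\<in>X. x) ` P i \<subseteq> P j" if "i \<in> I" for i
    using that indexed_partitionD(2)[OF assms that] by (intro bexI[of _ i]) auto
  then show "\<one>\<^bsub>full_transf X\<^esub> \<in> carrier (partition_transf X I P)"
    by (auto simp: partition_transf_def full_transf_def)
qed (auto simp: partition_transf_def)

lemma monoid_partition_transf:
  assumes "indexed_partition X I P"
  shows "monoid (partition_transf X I P)"
  using submonoid.submonoid_is_monoid[OF submonoid_partition_transf[OF assms] monoid_full_transf]
  by (simp add: partition_transf_def)

lemma submonoid_Sigma_transf:
  assumes P: "indexed_partition X I P"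
  shows "submonoid (carrier (Sigma_transf X I P)) (partition_transf X I P)"
proof
  fix f g
  assume f: "f \<in> carrier (Sigma_transf X I P)" and g: "g \<in> carrier (Sigma_transf X I P)"
  then have fg: "f \<in> carrier (partition_transf X I P)" "g \<in> carrier (partition_transf X I P)"
    by (auto simp: Sigma_transf_def)
  have "compose X g f ` X \<inter> P i \<noteq> {}" if i: "i \<in> I" for i
  proof -
    obtain x where x: "x \<in> X" "g x \<in> P i"
      using g i by (auto simp: Sigma_transf_def)
    obtain k where k: "k \<in> I" "x \<in> P k"
      using indexed_partitionD(3)[OF P] x by blast
    obtain y where y: "y \<in> X" "f y \<in> P k"
      using f k by (auto simp: Sigma_transf_def)
    obtain j where "j \<in> I" "g ` P k \<subseteq> P j"
      using fg k by (auto simp: partition_transf_def)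
    with x k have "g ` P k \<subseteq> P i"
      using indexed_partitionD(4)[OF P _ i] by blast
    with y show ?thesis
      by (auto simp: compose_def)
  qed
  moreover have "f \<otimes>\<^bsub>partition_transf X I P\<^esub> g \<in> carrier (partition_transf X I P)"
    using monoid.m_closed[OF monoid_partition_transf[OF P]] fg by blast
  ultimately show "f \<otimes>\<^bsub>partition_transf X I P\<^esub> g \<in> carrier (Sigma_transf X I P)"
    by (auto simp: Sigma_transf_def partition_transf_def full_transf_def)
next
  have "(\<lambda>x\<in>X. x) ` X \<inter> P i \<noteq> {}" if "i \<in> I" for i
    using indexed_partitionD(1,2)[OF P that] by auto
  then show "\<one>\<^bsub>partition_transf X I P\<^esub> \<in> carrier (Sigma_transf X I P)"
    using monoid.one_closed[OF monoid_partition_transf[OF P]]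
    by (auto simp: Sigma_transf_def partition_transf_def full_transf_def)
qed (auto simp: Sigma_transf_def)

lemma monoid_Sigma_transf:
  assumes "indexed_partition X I P"
  shows "monoid (Sigma_transf X I P)"
  using submonoid.submonoid_is_monoid[OF submonoid_Sigma_transf[OF assms] monoid_partition_transf[OF assms]]
  by (simp add: Sigma_transf_def)

end

theory Submission
  imports Defs
begin

text \<open>
  A map \<open>h: A \<rightarrow> B\<close> admits a bijection \<open>g: B \<rightarrow> A\<close> with \<open>hgh = h\<close> iff its collapse equals its
  defect: such a \<open>g\<close> sends the image of \<open>h\<close> onto a cross-section of the kernel, and hence the
  complement of the image onto the complement of the cross-section. If \<open>fuf = f\<close> for a unit \<open>u\<close>,
  then, as \<open>f\<close> meets every block, the permutation of \<open>I\<close> induced by \<open>u\<close> is inverse to the character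
  of \<open>f\<close>, so \<open>u\<close> restricts to such a \<open>g\<close> for every block map of \<open>f\<close>. Conversely, such bijections,
  one for each block, glue to a unit, because the character of \<open>f\<close> permutes \<open>I\<close>.
\<close>

section \<open>Collapse and defect of a single map\<close>

lemma collapse_eq_defect_iff:
  assumes h: "h ` A \<subseteq> B"
  shows "collapse A h =o defect A B h \<longleftrightarrow>
    (\<exists>g. bij_betw g B A \<and> (\<forall>x\<in>A. h (g (h x)) = h x))"
proof
  assume eq: "collapse A h =o defect A B h"
  obtain T where T: "cross_section A h T"
    using cross_section_exists by blast
  then have TA: "T \<subseteq> A" and ex1: "\<And>a. a \<in> A \<Longrightarrow> \<exists>!x. x \<in> T \<and> h x = h a"
    by (auto simp: cross_section_iff)
  have "|B - h ` A| =o |A - T|"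
    using eq collapse_cross_section[OF T] unfolding defect_def
    by (rule ordIso_transitive[OF ordIso_symmetric])
  then obtain k where k: "bij_betw k (B - h ` A) (A - T)"
    using card_of_ordIso by blast
  have "inj_on h T"
  proof (rule inj_onI)
    fix x y assume xy: "x \<in> T" "y \<in> T" "h x = h y"
    with TA have "\<exists>!z. z \<in> T \<and> h z = h y"
      by (intro ex1) blast
    with xy show "x = y"
      by blast
  qed
  moreover have "h ` T = h ` A"
  proof
    show "h ` A \<subseteq> h ` T"
    proof
      fix y assume "y \<in> h ` A"
      then obtain a where a: "a \<in> A" "y = h a"
        by blast
      obtain x where "x \<in> T" "h x = h a"
        using ex1[OF a(1)] by blast
      then show "y \<in> h ` T"
        using a by (intro image_eqI[of _ h x]) simp_all
    qed
  qed (use TA in blast)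
  ultimately have "bij_betw h T (h ` A)"
    by (simp add: bij_betw_def)
  then have inv: "bij_betw (inv_into T h) (h ` A) T"
    by (rule bij_betw_inv_into)
  \<comment> \<open>On the image of \<open>h\<close>, \<open>g\<close> picks the representative in
    \<open>T\<close>; the points that \<open>h\<close> misses are matched by \<open>k\<close> with
    the points outside \<open>T\<close>. The two pieces have disjoint domains and disjoint ranges,
    so \<open>g\<close> is a bijection.\<close>
  define g where "g y = (if y \<in> h ` A then inv_into T h y else k y)" for y
  have "bij_betw g (h ` A \<union> (B - h ` A)) (T \<union> (A - T))"
    unfolding g_def using inv k by (rule bij_betw_disjoint_Un) auto
  then have "bij_betw g B A"
    using h TA by (simp add: Un_absorb1 Un_Diff_cancel)
  moreover have "h (g (h x)) = h x" if "x \<in> A" for x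
    using that \<open>h ` T = h ` A\<close> by (auto simp: g_def intro: f_inv_into_f)
  ultimately show "\<exists>g. bij_betw g B A \<and> (\<forall>x\<in>A. h (g (h x)) = h x)"
    by blast
next
  assume "\<exists>g. bij_betw g B A \<and> (\<forall>x\<in>A. h (g (h x)) = h x)"
  then obtain g where g: "bij_betw g B A" and hgh: "\<And>x. x \<in> A \<Longrightarrow> h (g (h x)) = h x"
    by blast
  have gA: "g ` B = A" and inj: "inj_on g B"
    using g by (auto simp: bij_betw_def)
  \<comment> \<open>The kernel class of \<open>a\<close> is represented by \<open>g (h a)\<close>,
    since \<open>hgh\<close> = \<open>h\<close>; any other \<open>g (h b)\<close> in that class has
    \<open>h b = h a\<close> and hence is the same point.\<close>
  let ?T = "g ` h ` A"
  have T: "cross_section A h ?T"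
    unfolding cross_section_iff
  proof (intro conjI ballI)
    show "?T \<subseteq> A"
      using h gA by blast
    show "\<exists>!x. x \<in> ?T \<and> h x = h a" if "a \<in> A" for a
      using that hgh by (intro ex1I[of _ "g (h a)"]) auto
  qed
  have "g ` (B - h ` A) = A - ?T"
    using inj_on_image_set_diff[OF inj, of B "h ` A"] h gA by auto
  moreover have "inj_on g (B - h ` A)"
    using inj by (rule inj_on_subset) blast
  ultimately have "bij_betw g (B - h ` A) (A - ?T)"
    by (simp add: bij_betw_def)
  then have "|B - h ` A| =o |A - ?T|"
    using card_of_ordIso by blast
  with collapse_cross_section[OF T] show "collapse A h =o defect A B h"
    unfolding defect_def by (rule ordIso_transitive[OF _ ordIso_symmetric])
qed

section \<open>Elements and units of \<open>Sigma_transf\<close>\<close>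

lemma carrier_Sigma_transf_iff:
  "f \<in> carrier (Sigma_transf X I P) \<longleftrightarrow>
    f \<in> X \<rightarrow>\<^sub>E X \<and> (\<forall>i\<in>I. \<exists>j\<in>I. f ` P i \<subseteq> P j) \<and> (\<forall>i\<in>I. f ` X \<inter> P i \<noteq> {})"
  by (auto simp: Sigma_transf_def partition_transf_def full_transf_def)

lemma Sigma_transf_meets_block:
  assumes "f \<in> carrier (Sigma_transf X I P)" "j \<in> I"
  obtains x where "x \<in> X" "f x \<in> P j"
  using assms unfolding carrier_Sigma_transf_iff by blast

lemma mult_Sigma_transf: "f \<otimes>\<^bsub>Sigma_transf X I P\<^esub> g = compose X g f"
  by (simp add: Sigma_transf_def partition_transf_def full_transf_def)

lemma one_Sigma_transf: "\<one>\<^bsub>Sigma_transf X I P\<^esub> = (\<lambda>x\<in>X. x)"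
  by (simp add: Sigma_transf_def partition_transf_def full_transf_def)

text \<open>Say that \<open>v\<close> sends \<open>P i\<close> into \<open>P l\<close>. Then
  \<open>u\<close> sends \<open>P l\<close> back into \<open>P i\<close>, as it undoes
  \<open>v\<close>, so it is enough to identify \<open>l\<close> with \<open>j\<close>.\<close>

lemma unit_image_block:
  assumes P: "indexed_partition X I P"
    and f: "f \<in> carrier (Sigma_transf X I P)"
    and u: "u \<in> carrier (Sigma_transf X I P)" and v: "v \<in> carrier (Sigma_transf X I P)"
    and vu: "\<And>x. x \<in> X \<Longrightarrow> v (u x) = x" and uv: "\<And>x. x \<in> X \<Longrightarrow> u (v x) = x"
    and fuf: "\<And>x. x \<in> X \<Longrightarrow> f (u (f x)) = f x"
    and ij: "i \<in> I" "j \<in> I" "f ` P i \<subseteq> P j"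
  shows "u ` P j = P i"
proof -
  note sub = indexed_partitionD(2)[OF P] and uniq = indexed_partitionD(4)[OF P]
  obtain l where l: "l \<in> I" "v ` P i \<subseteq> P l"
    using v ij by (auto simp: carrier_Sigma_transf_iff)
  obtain k where k: "k \<in> I" "u ` P l \<subseteq> P k"
    using u l by (auto simp: carrier_Sigma_transf_iff)
  obtain z where z: "z \<in> P i"
    using indexed_partitionD(1)[OF P ij(1)] by blast
  then have "z \<in> P k"
    using l k uv sub[OF ij(1)] by (metis image_subset_iff subsetD)
  then have ki: "k = i"
    using uniq k ij z by blast
  \<comment> \<open>As \<open>f\<close> meets \<open>P l\<close>, pick a value \<open>f x\<close>
    there. Then \<open>u (f x)\<close> lies in \<open>P i\<close>, so
    \<open>f x = f (u (f x))\<close> lies in \<open>P j\<close>, which forces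
    \<open>l = j\<close>.\<close>
  obtain x where x: "x \<in> X" "f x \<in> P l"
    using f l(1) by (rule Sigma_transf_meets_block)
  then have "f x \<in> P j"
    using fuf[OF x(1)] k ki ij by (metis image_subset_iff)
  then have "l = j"
    using uniq l ij x by blast
  show ?thesis
  proof
    show "u ` P j \<subseteq> P i"
      using k ki \<open>l = j\<close> by simp
    show "P i \<subseteq> u ` P j"
    proof
      fix y assume y: "y \<in> P i"
      then have "v y \<in> P j" "u (v y) = y"
        using l \<open>l = j\<close> uv sub[OF ij(1)] by auto
      then show "y \<in> u ` P j"
        by (metis imageI)
    qed
  qed
qed

text \<open>Surjectivity of \<open>c\<close> lets the \<open>g i\<close> cover all of
  \<open>X\<close>, and injectivity of \<open>c\<close> makes the glued map well defined. Its
  inverse is glued from the inverses of the \<open>g i\<close>.\<close>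

lemma glue_block_bijections:
  assumes P: "indexed_partition X I P" and c: "bij_betw c I I"
    and g: "\<And>i. i \<in> I \<Longrightarrow> bij_betw (g i) (P (c i)) (P i)"
  shows "\<exists>u \<in> Units (Sigma_transf X I P). \<forall>i\<in>I. \<forall>y\<in>P (c i). u y = g i y"
proof -
  note ne = indexed_partitionD(1)[OF P] and sub = indexed_partitionD(2)[OF P]
    and cover = indexed_partitionD(3)[OF P] and uniq = indexed_partitionD(4)[OF P]
  have cI: "c i \<in> I" if "i \<in> I" for i
    using c that by (auto simp: bij_betw_def)
  have c_inj: "i = k" if "i \<in> I" "k \<in> I" "c i = c k" for i k
    using c that by (auto simp: bij_betw_def inj_on_def)
  have c_surj: "\<exists>i\<in>I. j = c i" if "j \<in> I" for j
    using c that by (auto simp: bij_betw_def)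
  define ix where "ix x = (THE i. i \<in> I \<and> x \<in> P i)" for x
  have ix: "ix x = i" if "i \<in> I" "x \<in> P i" for i x
    unfolding ix_def using that uniq by (intro the_equality) blast+
  \<comment> \<open>For \<open>y\<close> in \<open>X\<close>, this is the preimage under
    \<open>c\<close> of the index of the block of \<open>y\<close>: it selects which
    \<open>g i\<close> acts on \<open>y\<close>.\<close>
  define iy where "iy y = (THE i. i \<in> I \<and> y \<in> P (c i))" for y
  have iy: "iy y = i" if "i \<in> I" "y \<in> P (c i)" for i y
    unfolding iy_def using that uniq cI c_inj by (intro the_equality) blast+
  define u where "u = (\<lambda>y\<in>X. g (iy y) y)"
  define v where "v = (\<lambda>x\<in>X. inv_into (P (c (ix x))) (g (ix x)) x)"
  have u_eq: "u y = g i y" if "i \<in> I" "y \<in> P (c i)" for i y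
    using that sub cI iy by (auto simp: u_def)
  have v_eq: "v x = inv_into (P (c i)) (g i) x" if "i \<in> I" "x \<in> P i" for i x
    using that sub ix by (auto simp: v_def)
  have u_blk: "u y \<in> P i" if "i \<in> I" "y \<in> P (c i)" for i y
    using g[OF that(1)] that u_eq by (auto simp: bij_betw_def)
  have v_blk: "v x \<in> P (c i)" if "i \<in> I" "x \<in> P i" for i x
    using bij_betw_inv_into[OF g[OF that(1)]] that v_eq by (auto simp: bij_betw_def)
  have vu: "v (u y) = y" if y: "y \<in> X" for y
  proof -
    obtain i where i: "i \<in> I" "y \<in> P (c i)"
      using cover[OF y] c_surj by blast
    then have "v (u y) = inv_into (P (c i)) (g i) (g i y)"
      using v_eq u_blk u_eq by metis
    also have "\<dots> = y"
      using g i by (intro bij_betw_inv_into_left) auto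
    finally show ?thesis .
  qed
  have uv: "u (v x) = x" if x: "x \<in> X" for x
  proof -
    obtain i where i: "i \<in> I" "x \<in> P i"
      using cover[OF x] by blast
    then have "u (v x) = g i (inv_into (P (c i)) (g i) x)"
      using v_eq v_blk u_eq by metis
    also have "\<dots> = x"
      using g i by (intro bij_betw_inv_into_right) auto
    finally show ?thesis .
  qed
  have uX: "u \<in> X \<rightarrow>\<^sub>E X"
  proof (rule PiE_I)
    show "u y \<in> X" if y: "y \<in> X" for y
      using cover[OF y] c_surj u_blk sub by blast
  qed (simp add: u_def)
  have vX: "v \<in> X \<rightarrow>\<^sub>E X"
  proof (rule PiE_I)
    show "v x \<in> X" if x: "x \<in> X" for x
      using cover[OF x] cI v_blk sub by blast
  qed (simp add: v_def)
  have uS: "u \<in> carrier (Sigma_transf X I P)"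
    unfolding carrier_Sigma_transf_iff
  proof (intro conjI ballI)
    show "\<exists>j\<in>I. u ` P i \<subseteq> P j" if "i \<in> I" for i
      using c_surj[OF that] u_blk by blast
    \<comment> \<open>The block \<open>P i\<close> is met because the nonempty block
      \<open>P (c i)\<close> is sent into it.\<close>
    show "u ` X \<inter> P i \<noteq> {}" if "i \<in> I" for i
      using ne[of "c i"] sub[of "c i"] cI[OF that] u_blk[OF that] by blast
  qed (rule uX)
  have vS: "v \<in> carrier (Sigma_transf X I P)"
    unfolding carrier_Sigma_transf_iff
  proof (intro conjI ballI)
    show "\<exists>j\<in>I. v ` P i \<subseteq> P j" if "i \<in> I" for i
      using cI[OF that] v_blk[OF that] by blast
    show "v ` X \<inter> P j \<noteq> {}" if j: "j \<in> I" for j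
    proof -
      obtain i where i: "i \<in> I" "j = c i"
        using c_surj[OF j] by blast
      then show ?thesis
        using ne[of i] sub[of i] v_blk[of i] by blast
    qed
  qed (rule vX)
  have "compose X u v = (\<lambda>x\<in>X. x)" "compose X v u = (\<lambda>x\<in>X. x)"
    using uv vu by (auto simp: compose_def)
  with uS vS have "u \<in> Units (Sigma_transf X I P)"
    by (auto simp: Units_def mult_Sigma_transf one_Sigma_transf)
  with u_eq show ?thesis
    by blast
qed

theorem proposition5p4:
  fixes X :: "'a set" and I :: "'i set" and P :: "'i \<Rightarrow> 'a set" and f :: "'a \<Rightarrow> 'a"
  assumes "X \<noteq> {}"
    and "indexed_partition X I P"
    and "f \<in> carrier (Sigma_transf X I P)"
  shows "unit_regular (Sigma_transf X I P) f \<longleftrightarrow>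
    character I P f \<in> carrier (inj_transf I) \<and>
    (\<forall>i\<in>I. \<forall>j\<in>I. character I P f i = j \<longrightarrow>
       |P i| =o |P j| \<and>
       collapse (P i) (block_map P f i) =o defect (P i) (P j) (block_map P f i))"
proof -
  note P = assms(2) and f = assms(3)
  let ?c = "character I P f"
  note sub = indexed_partitionD(2)[OF P] and cover = indexed_partitionD(3)[OF P]
    and uniq = indexed_partitionD(4)[OF P]
  have fp: "f \<in> carrier (partition_transf X I P)"
    using f by (simp add: Sigma_transf_def)
  note c_iff = character_eq_iff[OF P fp]
  have cI: "?c i \<in> I" if i: "i \<in> I" for i
  proof -
    obtain j where "j \<in> I" "f ` P i \<subseteq> P j"
      using f i by (auto simp: carrier_Sigma_transf_iff)
    then show ?thesis
      using c_iff[OF i] by auto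
  qed
  have cP: "f ` P i \<subseteq> P (?c i)" if "i \<in> I" for i
    using c_iff[OF that cI[OF that]] by simp
  have fE: "f \<in> extensional X"
    using f by (auto simp: carrier_Sigma_transf_iff PiE_def)
  \<comment> \<open>The character is always an extensional selfmap of \<open>I\<close>, so condition
    (i) reduces to injectivity.\<close>
  have c_carrier: "?c \<in> carrier (inj_transf I) \<longleftrightarrow> inj_on ?c I"
    using cI by (auto simp: inj_transf_def full_transf_def character_def)
  \<comment> \<open>Restates the collapse condition in terms of \<open>f\<close> itself:
    \<open>g\<close> returns to \<open>P i\<close>, where \<open>f\<close> and its block map
    agree.\<close>
  have blk: "collapse (P i) (block_map P f i) =o defect (P i) (P j) (block_map P f i) \<longleftrightarrow>
      (\<exists>g. bij_betw g (P j) (P i) \<and> (\<forall>x\<in>P i. f x \<in> P j \<longrightarrow> f (g (f x)) = f x))"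
    if "i \<in> I" "j \<in> I" "?c i = j" for i j
  proof -
    have fij: "f ` P i \<subseteq> P j"
      using cP that by blast
    have "block_map P f i (g (block_map P f i x)) = f (g (f x))"
      if "bij_betw g (P j) (P i)" "x \<in> P i" for g x
      using that fij by (auto simp: block_map_def bij_betw_def)
    moreover have "block_map P f i ` P i \<subseteq> P j"
      using fij by (simp add: block_map_def)
    moreover have "block_map P f i x = f x" if "x \<in> P i" for x
      using that by (simp add: block_map_def)
    ultimately show ?thesis
      using fij by (subst collapse_eq_defect_iff) (auto simp: image_subset_iff)
  qed
  show ?thesis
  proof (intro iffI conjI)
    assume "unit_regular (Sigma_transf X I P) f"
    then obtain u v where u: "u \<in> carrier (Sigma_transf X I P)"
      and v: "v \<in> carrier (Sigma_transf X I P)"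
      and uv1: "compose X u v = (\<lambda>x\<in>X. x)" and vu1: "compose X v u = (\<lambda>x\<in>X. x)"
      and fuf1: "compose X f (compose X u f) = f"
      by (auto simp: unit_regular_def Units_def mult_Sigma_transf one_Sigma_transf)
    have uv: "u (v x) = x" and vu: "v (u x) = x" and fuf: "f (u (f x)) = f x" if "x \<in> X" for x
      using that fun_cong[OF uv1, of x] fun_cong[OF vu1, of x] fun_cong[OF fuf1, of x]
      by (simp_all add: compose_eq)
    have img: "u ` P (?c i) = P i" if "i \<in> I" for i
      using unit_image_block[OF P f u v vu uv fuf that cI[OF that] cP[OF that]] .
    have bij: "bij_betw u (P (?c i)) (P i)" if "i \<in> I" for i
      unfolding bij_betw_def
      using img[OF that] sub[OF cI[OF that]] vu by (auto intro: inj_on_inverseI[of _ v])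
    have "inj_on ?c I"
    proof (rule inj_onI)
      fix i k assume ik: "i \<in> I" "k \<in> I" "?c i = ?c k"
      \<comment> \<open>Both blocks are the image under \<open>u\<close> of the same block.\<close>
      then have "P i = P k"
        using img by metis
      with ik indexed_partitionD(1)[OF P] uniq show "i = k"
        by blast
    qed
    then show "?c \<in> carrier (inj_transf I)"
      by (simp add: c_carrier)
    show "\<forall>i\<in>I. \<forall>j\<in>I. ?c i = j \<longrightarrow> |P i| =o |P j| \<and>
       collapse (P i) (block_map P f i) =o defect (P i) (P j) (block_map P f i)"
    proof (intro ballI impI conjI)
      fix i j assume ij: "i \<in> I" "j \<in> I" "?c i = j"
      \<comment> \<open>The restriction of the unit to \<open>P j\<close> serves twice: it compares
        the sizes of the blocks and it is the bijection demanded by \<open>blk\<close>.\<close>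
      then have b: "bij_betw u (P j) (P i)"
        using bij by blast
      then show "|P i| =o |P j|"
        using card_of_ordIso ordIso_symmetric by blast
      show "collapse (P i) (block_map P f i) =o defect (P i) (P j) (block_map P f i)"
        unfolding blk[OF ij] using b fuf sub[OF ij(1)] by blast
    qed
  next
    assume *: "?c \<in> carrier (inj_transf I) \<and> (\<forall>i\<in>I. \<forall>j\<in>I. ?c i = j \<longrightarrow> |P i| =o |P j| \<and>
       collapse (P i) (block_map P f i) =o defect (P i) (P j) (block_map P f i))"
    \<comment> \<open>Surjectivity of the character comes from \<open>f\<close> meeting every block;
      with (i) the character is then a permutation, even for infinite \<open>I\<close>.\<close>
    have "I \<subseteq> ?c ` I"
    proof
      fix j assume j: "j \<in> I"
      with f obtain x where x: "x \<in> X" "f x \<in> P j"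
        by (rule Sigma_transf_meets_block)
      obtain i where i: "i \<in> I" "x \<in> P i"
        using cover[OF x(1)] by blast
      then have "?c i = j"
        using uniq[OF cI[OF i(1)] j] cP[OF i(1)] x by blast
      with i show "j \<in> ?c ` I"
        by blast
    qed
    then have c: "bij_betw ?c I I"
      using * cI by (auto simp: c_carrier bij_betw_def)
    have "\<forall>i\<in>I. \<exists>g. bij_betw g (P (?c i)) (P i) \<and>
        (\<forall>x\<in>P i. f x \<in> P (?c i) \<longrightarrow> f (g (f x)) = f x)"
      using * blk cI by blast
    then obtain g where g: "\<And>i. i \<in> I \<Longrightarrow> bij_betw (g i) (P (?c i)) (P i)"
      and fgf: "\<And>i x. i \<in> I \<Longrightarrow> x \<in> P i \<Longrightarrow> f x \<in> P (?c i) \<Longrightarrow> f (g i (f x)) = f x"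
      by metis
    obtain u where u: "u \<in> Units (Sigma_transf X I P)"
      and ug: "\<And>i y. i \<in> I \<Longrightarrow> y \<in> P (?c i) \<Longrightarrow> u y = g i y"
      using glue_block_bijections[OF P c g] by blast
    have "f (u (f x)) = f x" if x: "x \<in> X" for x
    proof -
      obtain i where i: "i \<in> I" "x \<in> P i"
        using cover[OF x] by blast
      then have "f x \<in> P (?c i)"
        using cP by blast
      with i show ?thesis
        using ug fgf by simp
    qed
    \<comment> \<open>Both sides are extensional on \<open>X\<close>, so agreement on
      \<open>X\<close> gives equality of functions.\<close>
    then have "compose X f (compose X u f) = f"
      using fE by (intro extensionalityI[of _ X]) (auto simp: compose_eq)
    with u f show "unit_regular (Sigma_transf X I P) f"
      by (auto simp: unit_regular_def mult_Sigma_transf)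
  qed
qed

end
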